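(* Let $(A,r)$ be a greedy system with respect to $(\mathcal{L},\preceq)$ satisfying the standing assumptions, with truncation $(A',r)$, let $c\in\mathbb{R}_{\ge0}^E$, and let $(x^*,y^* )$ be a solution returned by the primal-dual greedy algorithm applied to the truncation (i.e. with $M=A'$). Let $\mathrm{OPT}$ be the optimal value of (P). Define $b=1$ if $\frac{r(S)^+-r(\varphi_e(S))^+}{a'_{S,e}}\in\mathbb{Z}_{\ge0}$ for all $S\in\mathcal{L}$ and $e\in S$ with $a'_{S,e}>0$, and $b=2$ otherwise. Then $c^Tx^*\le b\,\delta\,\mathrm{OPT}$ if $r$ is non-negative, and $c^Tx^*\le (b\,\delta+1)\,\mathrm{OPT}$ otherwise.
   Context: Let $E$ be a finite set of columns (elements), $\mathcal{L}$ a finite set of row indices, $A=(a_{i,e})\in\mathbb{R}_{\ge 0}^{\mathcal{L}\times E}$, $r:\mathcal{L}\to\mathbb{R}$. For a row $i$ let $\mathrm{supp}(i)=\{e\in E: a_{i,e}>0\}$. Let $\preceq$ be a partial order on $\mathcal{L}$. The system $(A,r)$ is a greedy system with respect to $(\mathcal{L},\preceq)$ if: (P1) $r(S)\le r(T)$ whenever $S\preceq T$; (P2) for every $e\in E$, $a_{S,e}\le a_{T,e}$ whenever $S\preceq T$; (P3) $(\mathcal{L},\preceq)$ is a modular lattice with join $\vee$ and meet $\wedge$, distinct rows have distinct supports, and for all $i,j\in\mathcal{L}$, $e\in E$: $e\notin\mathrm{supp}(i)\cup\mathrm{supp}(j)$ implies $e\notin\mathrm{supp}(i\vee j)$; (P4)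 $\frac{r(T)-r(S\wedge T)}{a_{T,e}}\le\frac{r(S\vee T)-r(S)}{a_{S\vee T,e}}$ for all $S,T\in\mathcal{L}$ and $e\in T\setminus(S\wedge T)$. Each row is identified with its support: $S\in\mathcal{L}$ denotes the row with support $S\subseteq E$, and $e\in S$ means $a_{S,e}>0$. Standing assumptions: there is a row with empty support and nonpositive rank, and a row with support $E$ (denoted $E$; it is the maximum of $\mathcal{L}$). For $S\in\mathcal{L}$ and $e\in E$, $\varphi_e(S)=\max\{T\in\mathcal{L}: T\preceq S,\ e\notin T\}$; $t^+=\max\{t,0\}$. The truncation is $(A',r)$ with $a'_{S,e}=\min\{a_{S,e},\ r(S)^+-r(\varphi_e(S))^+\}$. Problem (P): $\min\{c^Tx: Ax\ge r,\ x\in\mathbb{Z}_{\ge0}^E\}$. For $S\in\mathcal{L}$, $e\in E$ set $\delta_{S,e}=a'_{E,e}/a'_{S,e}$ if $a'_{S,e}>0$ and ($r(\varphi_e(S))\ge0$ or $a'_{S,e}=a_{S,e}$), and $\delta_{S,e}=1$ otherwise; $\delta=\max_{S,e}\delta_{S,e}$. The primal-dual greedy algorithm applied to a matrix $M=(m_{S,e})$ on the rows $\mathcal{L}$ and rank $r$: let $S_1$ be the maximum element of $\mathcal{L}$, $y\equiv0$, $E^*=\emptyset$, $j=1$. While $r(S_j)>0$: increase $y_{S_j}$ until the dual constraint $\sum_S m_{S,e}y_S\le c_e$ of some element $e_j\in E\setminus E^*$ (with $m_{S_j,e_j}>0$) becomes tight; add $e_j$ to $E^*$; set $S_{j+1}=\varphi_{e_j}(S_j)$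 and $j\leftarrow j+1$. If $\ell$ iterations were performed, output $y^*=y$ and $x^*$ with $x^*_{e_j}=\left\lceil\frac{r(S_j)^+-r(S_{j+1})^+}{m_{S_j,e_j}}\right\rceil$ for $j=1,\dots,\ell$ and $x^*_e=0$ otherwise. *)

theory Defs
  imports Complex_Main "HOL-Algebra.Lattice"
begin

locale modular_lattice = lattice +
  assumes modular:
    "\<lbrakk>x \<in> carrier L; y \<in> carrier L; z \<in> carrier L; x \<sqsubseteq> z\<rbrakk> \<Longrightarrow> x \<squnion> (y \<sqinter> z) = (x \<squnion> y) \<sqinter> z"

definition supp :: "'e set \<Rightarrow> ('l \<Rightarrow> 'e \<Rightarrow> real) \<Rightarrow> 'l \<Rightarrow> 'e set" where
  "supp E A S = {e \<in> E. A S e > 0}"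

text \<open>
  The rows are the carrier of \<open>L\<close>, the columns are \<open>E\<close>. In \<open>supermodular\<close> both
  denominators are positive: \<open>e \<in> supp E A T\<close>, and \<open>col_mono\<close> gives
  \<open>A T e \<le> A (S \<squnion> T) e\<close>.
\<close>

locale greedy_system = modular_lattice L
  for E :: "'e set" and L :: "('l, 'm) gorder_scheme" (structure)
    and A :: "'l \<Rightarrow> 'e \<Rightarrow> real" and r :: "'l \<Rightarrow> real" +
  assumes finite_columns: "finite E"
    and finite_rows: "finite (carrier L)"
    and nonneg: "\<lbrakk>S \<in> carrier L; e \<in> E\<rbrakk> \<Longrightarrow> A S e \<ge> 0"
    and rank_mono: "\<lbrakk>S \<in> carrier L; T \<in> carrier L; S \<sqsubseteq> T\<rbrakk> \<Longrightarrow> r S \<le> r T"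
    and col_mono: "\<lbrakk>S \<in> carrier L; T \<in> carrier L; S \<sqsubseteq> T; e \<in> E\<rbrakk> \<Longrightarrow> A S e \<le> A T e"
    and supp_inj: "inj_on (supp E A) (carrier L)"
    and supp_join: "\<lbrakk>S \<in> carrier L; T \<in> carrier L; e \<in> E; e \<notin> supp E A S \<union> supp E A T\<rbrakk>
      \<Longrightarrow> e \<notin> supp E A (S \<squnion> T)"
    and supermodular:
      "\<lbrakk>S \<in> carrier L; T \<in> carrier L; e \<in> supp E A T - supp E A (S \<sqinter> T)\<rbrakk>
      \<Longrightarrow> (r T - r (S \<sqinter> T)) / A T e \<le> (r (S \<squnion> T) - r S) / A (S \<squnion> T) e"

definition phi :: "'e set \<Rightarrow> ('l, 'm) gorder_scheme \<Rightarrow> ('l \<Rightarrow> 'e \<Rightarrow> real) \<Rightarrow> 'e \<Rightarrow> 'l \<Rightarrow> 'l" where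
  "phi E L A e S =
    (THE T. greatest L T {T \<in> carrier L. T \<sqsubseteq>\<^bsub>L\<^esub> S \<and> e \<notin> supp E A T})"

definition rank_drop ::
  "'e set \<Rightarrow> ('l, 'm) gorder_scheme \<Rightarrow> ('l \<Rightarrow> 'e \<Rightarrow> real) \<Rightarrow> ('l \<Rightarrow> real) \<Rightarrow> 'l \<Rightarrow> 'e \<Rightarrow> real" where
  "rank_drop E L A r S e = max (r S) 0 - max (r (phi E L A e S)) 0"

definition truncation ::
  "'e set \<Rightarrow> ('l, 'm) gorder_scheme \<Rightarrow> ('l \<Rightarrow> 'e \<Rightarrow> real) \<Rightarrow> ('l \<Rightarrow> real) \<Rightarrow> 'l \<Rightarrow> 'e \<Rightarrow> real" where
  "truncation E L A r S e = min (A S e) (rank_drop E L A r S e)"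

definition full_row :: "'e set \<Rightarrow> ('l, 'm) gorder_scheme \<Rightarrow> ('l \<Rightarrow> 'e \<Rightarrow> real) \<Rightarrow> 'l" where
  "full_row E L A = (THE S. S \<in> carrier L \<and> supp E A S = E)"

definition delta_entry ::
  "'e set \<Rightarrow> ('l, 'm) gorder_scheme \<Rightarrow> ('l \<Rightarrow> 'e \<Rightarrow> real) \<Rightarrow> ('l \<Rightarrow> real) \<Rightarrow> 'l \<Rightarrow> 'e \<Rightarrow> real" where
  "delta_entry E L A r S e =
    (if truncation E L A r S e > 0 \<and>
        (r (phi E L A e S) \<ge> 0 \<or> truncation E L A r S e = A S e)
     then truncation E L A r (full_row E L A) e / truncation E L A r S e
     else 1)"

text \<open>The maximum is over an empty set, hence unspecified, only if there are no columns or no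
  rows.\<close>

definition delta ::
  "'e set \<Rightarrow> ('l, 'm) gorder_scheme \<Rightarrow> ('l \<Rightarrow> 'e \<Rightarrow> real) \<Rightarrow> ('l \<Rightarrow> real) \<Rightarrow> real" where
  "delta E L A r = Max ((\<lambda>(S, e). delta_entry E L A r S e) ` (carrier L \<times> E))"

definition b_factor ::
  "'e set \<Rightarrow> ('l, 'm) gorder_scheme \<Rightarrow> ('l \<Rightarrow> 'e \<Rightarrow> real) \<Rightarrow> ('l \<Rightarrow> real) \<Rightarrow> real" where
  "b_factor E L A r =
    (if \<forall>S \<in> carrier L. \<forall>e \<in> supp E A S. truncation E L A r S e > 0 \<longrightarrow>
          rank_drop E L A r S e / truncation E L A r S e \<in> \<nat>
     then 1 else 2)"

definition cost :: "'e set \<Rightarrow> ('e \<Rightarrow> real) \<Rightarrow> ('e \<Rightarrow> int) \<Rightarrow> real" where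
  "cost E c x = (\<Sum>e\<in>E. c e * of_int (x e))"

definition feasible ::
  "'e set \<Rightarrow> ('l, 'm) gorder_scheme \<Rightarrow> ('l \<Rightarrow> 'e \<Rightarrow> real) \<Rightarrow> ('l \<Rightarrow> real) \<Rightarrow> ('e \<Rightarrow> int) \<Rightarrow> bool" where
  "feasible E L A r x \<longleftrightarrow>
    (\<forall>e \<in> E. x e \<ge> 0) \<and> (\<forall>S \<in> carrier L. (\<Sum>e\<in>E. A S e * of_int (x e)) \<ge> r S)"

text \<open>
  For a greedy system whose only row of empty support has nonpositive rank, and nonnegative
  costs, a feasible integer vector exists and the infimum is attained, so it is the minimum.
\<close>

definition opt ::
  "'e set \<Rightarrow> ('l, 'm) gorder_scheme \<Rightarrow> ('l \<Rightarrow> 'e \<Rightarrow> real) \<Rightarrow> ('l \<Rightarrow> real) \<Rightarrow> ('e \<Rightarrow> real) \<Rightarrow> real" where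
  "opt E L A r c = Inf {cost E c x |x. feasible E L A r x}"

text \<open>
  \<open>pd_state E L A r c M S F y x\<close>: after finitely many iterations of the primal-dual greedy
  algorithm run on the matrix \<open>M\<close>, the current row is \<open>S\<close>, the set of chosen columns is \<open>F\<close>,
  and \<open>y\<close>, \<open>x\<close> are the dual and primal vectors built so far. The matrix \<open>A\<close> only provides the
  supports that define \<open>phi\<close>. In a step, \<open>t\<close> is the amount by which the dual variable of \<open>S\<close>
  is increased; the last two premises say that the constraint of \<open>e\<close> is among the first to
  become tight. Ties are broken arbitrarily.
\<close>

inductive pd_state ::
  "'e set \<Rightarrow> ('l, 'm) gorder_scheme \<Rightarrow> ('l \<Rightarrow> 'e \<Rightarrow> real) \<Rightarrow> ('l \<Rightarrow> real) \<Rightarrow> ('e \<Rightarrow> real) \<Rightarrow>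
   ('l \<Rightarrow> 'e \<Rightarrow> real) \<Rightarrow> 'l \<Rightarrow> 'e set \<Rightarrow> ('l \<Rightarrow> real) \<Rightarrow> ('e \<Rightarrow> int) \<Rightarrow> bool"
  for E :: "'e set" and L :: "('l, 'm) gorder_scheme" and A :: "'l \<Rightarrow> 'e \<Rightarrow> real"
    and r :: "'l \<Rightarrow> real" and c :: "'e \<Rightarrow> real" and M :: "'l \<Rightarrow> 'e \<Rightarrow> real"
where
  init: "pd_state E L A r c M \<top>\<^bsub>L\<^esub> {} (\<lambda>_. 0) (\<lambda>_. 0)"
| step: "\<lbrakk>pd_state E L A r c M S F y x;
          r S > 0;
          e \<in> E - F; M S e > 0;
          t \<ge> 0; y' = y(S := y S + t);
          (\<Sum>T\<in>carrier L. M T e * y' T) = c e;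
          \<forall>f \<in> E - F. M S f > 0 \<longrightarrow> (\<Sum>T\<in>carrier L. M T f * y' T) \<le> c f\<rbrakk>
  \<Longrightarrow> pd_state E L A r c M (phi E L A e S) (insert e F) y'
        (x(e := \<lceil>(max (r S) 0 - max (r (phi E L A e S)) 0) / M S e\<rceil>))"

definition pd_greedy_output ::
  "'e set \<Rightarrow> ('l, 'm) gorder_scheme \<Rightarrow> ('l \<Rightarrow> 'e \<Rightarrow> real) \<Rightarrow> ('l \<Rightarrow> real) \<Rightarrow> ('e \<Rightarrow> real) \<Rightarrow>
   ('l \<Rightarrow> 'e \<Rightarrow> real) \<Rightarrow> ('e \<Rightarrow> int) \<Rightarrow> ('l \<Rightarrow> real) \<Rightarrow> bool" where
  "pd_greedy_output E L A r c M x y \<longleftrightarrow> (\<exists>S F. pd_state E L A r c M S F y x \<and> \<not> r S > 0)"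

end

theory Submission
  imports Defs
begin

text \<open>
  Every integer solution of \<open>A x \<ge> r\<close> also satisfies the truncated system, so the dual solution
  built by the algorithm bounds \<open>OPT\<close> from below. Charge the cost of \<open>x\<^sup>*\<close> to the dual. In a
  row \<open>T\<close> with \<open>y\<^sub>T > 0\<close>, a step from \<open>S\<^sub>j\<close> to \<open>S\<^sub>j\<^sub>+\<^sub>1\<close> of nonnegative rank contributes at most
  \<open>b \<delta>\<close> times the rank drop, and these drops telescope to at most \<open>r T\<close>. Only the last step can
  reach negative rank, and then it contributes at most one further \<open>r T\<close>.
\<close>

locale bounded_greedy_system = greedy_system +
  assumes empty_row: "\<exists>S \<in> carrier L. supp E A S = {} \<and> r S \<le> 0"
    and full_row: "\<exists>S \<in> carrier L. supp E A S = E"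
begin

abbreviation "\<phi> \<equiv> phi E L A"
abbreviation "rdrop \<equiv> rank_drop E L A r"
abbreviation "A' \<equiv> truncation E L A r"

section \<open>Supports and the extreme rows\<close>

lemma supp_mono:
  assumes "S \<in> carrier L" "T \<in> carrier L" "S \<sqsubseteq> T"
  shows "supp E A S \<subseteq> supp E A T"
  using col_mono[OF assms] by (force simp: supp_def)

lemma not_supp_iff:
  assumes "S \<in> carrier L" "e \<in> E"
  shows "e \<notin> supp E A S \<longleftrightarrow> A S e = 0"
  using nonneg[OF assms] assms by (auto simp: supp_def)

text \<open>The meet \<open>B \<sqinter> S\<close> also has empty support, so it is \<open>B\<close>
  because supports determine rows. The full row is handled dually with joins.\<close>

lemma empty_row_least:
  assumes "B \<in> carrier L" "supp E A B = {}" "S \<in> carrier L"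
  shows "B \<sqsubseteq> S"
proof -
  have m: "B \<sqinter> S \<in> carrier L" using assms by simp
  have "supp E A (B \<sqinter> S) = supp E A B"
    using supp_mono[OF m assms(1)] meet_left assms by auto
  then have "B \<sqinter> S = B" using supp_inj m assms(1) by (auto dest: inj_onD)
  then show ?thesis using meet_right[OF assms(1,3)] by simp
qed

lemma full_row_greatest:
  assumes "U \<in> carrier L" "supp E A U = E" "S \<in> carrier L"
  shows "S \<sqsubseteq> U"
proof -
  have m: "U \<squnion> S \<in> carrier L" using assms by simp
  have "supp E A (U \<squnion> S) = supp E A U"
    using supp_mono[OF assms(1) m] join_left[OF assms(1,3)] assms by (auto simp: supp_def)
  then have "U \<squnion> S = U" using supp_inj m assms(1) by (auto dest: inj_onD)
  then show ?thesis using join_right[OF assms(1,3)] by simp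
qed

lemma rank_nonpos_if_supp_empty:
  assumes "S \<in> carrier L" "supp E A S = {}"
  shows "r S \<le> 0"
  using empty_row supp_inj assms by (metis inj_onD)

text \<open>Links the start row \<open>\<top>\<close> of the algorithm with the row
  \<open>full_row\<close> that occurs in \<open>delta_entry\<close>.\<close>

lemma full_row_eqs:
  shows full_row_closed: "full_row E L A \<in> carrier L"
    and le_full_row: "S \<in> carrier L \<Longrightarrow> S \<sqsubseteq> full_row E L A"
    and top_eq_full_row: "\<top> = full_row E L A"
proof -
  obtain U where U: "U \<in> carrier L" "supp E A U = E" using full_row by auto
  have f: "full_row E L A = U"
    unfolding full_row_def using U supp_inj by (intro the_equality) (auto dest: inj_onD)
  have g: "greatest L U (carrier L)"
    using full_row_greatest[OF U] U by (auto simp: greatest_def)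
  have "\<top> = U" unfolding top_def
    using g greatest_unique by (intro some_equality) auto
  then show "\<top> = full_row E L A" "full_row E L A \<in> carrier L"
    and "S \<in> carrier L \<Longrightarrow> S \<sqsubseteq> full_row E L A"
    using f U full_row_greatest[OF U] by auto
qed

section \<open>The greatest row avoiding a column\<close>

text \<open>By induction, every finite part of \<open>X\<close> has an upper bound inside
  \<open>X\<close>; as there are finitely many rows, \<open>X\<close> itself is such a part.\<close>

lemma join_closed_has_greatest:
  assumes X: "X \<subseteq> carrier L" "X \<noteq> {}"
    and join: "\<And>S T. S \<in> X \<Longrightarrow> T \<in> X \<Longrightarrow> S \<squnion> T \<in> X"
  shows "\<exists>T. greatest L T X"
proof -
  have "\<exists>u\<in>X. \<forall>y\<in>Y. y \<sqsubseteq> u" if "finite Y" "Y \<subseteq> X" for Y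
    using that
  proof (induction Y rule: finite_induct)
    case empty
    then show ?case using X by auto
  next
    case (insert a Y)
    then obtain u where u: "u \<in> X" "\<forall>y\<in>Y. y \<sqsubseteq> u" by auto
    have a: "a \<in> X" using insert by simp
    have c: "a \<in> carrier L" "u \<in> carrier L" "a \<squnion> u \<in> carrier L"
      using a u(1) X join[OF a u(1)] by blast+
    have "y \<sqsubseteq> a \<squnion> u" if "y \<in> insert a Y" for y
    proof (cases "y = a")
      case False
      then have "y \<sqsubseteq> u" "y \<in> carrier L" using that u insert X by auto
      then show ?thesis using le_trans[OF _ join_right[OF c(1,2)]] c by auto
    qed (use join_left c in auto)
    then show ?case using join[OF a u(1)] by blast
  qed
  from this[of X] show ?thesis
    using finite_subset[OF X(1) finite_rows] X by (auto simp: greatest_def)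
qed

text \<open>By (P3) the rows below \<open>S\<close> that avoid \<open>e\<close> are closed under
  joins, and the row of empty support is one of them. This makes the description in
  \<open>phi\<close> well defined.\<close>

lemma phi_greatest:
  assumes "S \<in> carrier L" "e \<in> E"
  shows "greatest L (\<phi> e S) {T \<in> carrier L. T \<sqsubseteq> S \<and> e \<notin> supp E A T}"
proof -
  have "\<exists>T. greatest L T {T \<in> carrier L. T \<sqsubseteq> S \<and> e \<notin> supp E A T}"
  proof (rule join_closed_has_greatest)
    show "{T \<in> carrier L. T \<sqsubseteq> S \<and> e \<notin> supp E A T} \<noteq> {}"
      using empty_row empty_row_least assms(1) by blast
  qed (use assms supp_join join_le in auto)
  then show ?thesis unfolding phi_def using greatest_unique by (metis (no_types, lifting) theI)
qed

lemma
  assumes "S \<in> carrier L" "e \<in> E"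
  shows phi_closed: "\<phi> e S \<in> carrier L" and phi_le: "\<phi> e S \<sqsubseteq> S"
    and phi_not_supp: "e \<notin> supp E A (\<phi> e S)"
    and le_phiI: "\<lbrakk>T \<in> carrier L; T \<sqsubseteq> S; e \<notin> supp E A T\<rbrakk> \<Longrightarrow> T \<sqsubseteq> \<phi> e S"
  using phi_greatest[OF assms] by (auto simp: greatest_def)

text \<open>Both sides are the greatest row below \<open>T\<close> that avoids \<open>e\<close>.
  This identifies the meet in the instance of (P4) used for rank drops.\<close>

lemma phi_restrict:
  assumes "S \<in> carrier L" "T \<in> carrier L" "T \<sqsubseteq> S" "e \<in> E"
  shows "\<phi> e S \<sqinter> T = \<phi> e T"
proof -
  note c = phi_closed[OF assms(1,4)] phi_closed[OF assms(2,4)] assms(1,2)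
  have m: "\<phi> e S \<sqinter> T \<in> carrier L" using c by simp
  have "\<phi> e S \<sqinter> T \<sqsubseteq> \<phi> e T"
    using m c meet_left[OF c(1,4)] meet_right[OF c(1,4)] supp_mono[OF m c(1)]
      phi_not_supp[OF assms(1,4)]
    by (intro le_phiI assms) auto
  moreover have "\<phi> e T \<sqsubseteq> \<phi> e S \<sqinter> T"
    using c phi_le[OF assms(2,4)] le_trans[OF phi_le[OF assms(2,4)] assms(3)] phi_not_supp[OF assms(2,4)]
    by (intro meet_le le_phiI assms) auto
  ultimately show ?thesis using le_antisym m c by auto
qed

section \<open>Monotonicity of rank drops and truncated entries\<close>

lemma rank_drop_nonneg:
  assumes "S \<in> carrier L" "e \<in> E"
  shows "0 \<le> rdrop S e"
  using rank_mono[OF phi_closed[OF assms] assms(1) phi_le[OF assms]]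
  by (auto simp: rank_drop_def)

lemma truncation_nonneg:
  assumes "S \<in> carrier L" "e \<in> E"
  shows "0 \<le> A' S e"
  using rank_drop_nonneg[OF assms] nonneg[OF assms] by (simp add: truncation_def)

lemma truncation_eq_0:
  assumes "S \<in> carrier L" "e \<in> E" "e \<notin> supp E A S"
  shows "A' S e = 0"
  using assms rank_drop_nonneg not_supp_iff by (auto simp: truncation_def)

lemma truncation_le_rank:
  assumes "S \<in> carrier L" "e \<in> E"
  shows "A' S e \<le> max (r S) 0"
  by (auto simp: truncation_def rank_drop_def)

text \<open>(P4) applied to \<open>\<phi> e S\<close> and \<open>T\<close>, whose meet is \<open>\<phi> e T\<close>; passing to positive parts uses
  that \<open>t \<mapsto> max t 0\<close> is convex and increasing.\<close>
lemma rank_drop_mono: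
  assumes S: "S \<in> carrier L" and T: "T \<in> carrier L" and TS: "T \<sqsubseteq> S" and e: "e \<in> supp E A T"
  shows "rdrop T e \<le> rdrop S e"
proof -
  have eE: "e \<in> E" using e by (simp add: supp_def)
  let ?P = "\<phi> e S" and ?Q = "\<phi> e T"
  let ?R = "?P \<squnion> T"
  have P: "?P \<in> carrier L" and Q: "?Q \<in> carrier L" using phi_closed S T eE by auto
  have R: "?R \<in> carrier L" using P T by simp
  have TR: "T \<sqsubseteq> ?R" using join_right P T by simp
  have meet: "?P \<sqinter> T = ?Q" using phi_restrict S T TS eE by simp
  have QP: "r ?Q \<le> r ?P" using meet_left[OF P T] meet rank_mono[OF Q P] by simp
  have QT: "r ?Q \<le> r T" using rank_mono[OF Q T phi_le[OF T eE]] .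
  have RS: "r ?R \<le> r S" using rank_mono[OF R S] join_le[OF phi_le[OF S eE] TS P T S] by simp
  have pos: "0 < A T e" using e by (simp add: supp_def)
  have le: "A T e \<le> A ?R e" using col_mono[OF T R TR eE] .
  have "(r T - r ?Q) / A T e \<le> (r ?R - r ?P) / A ?R e"
    using supermodular[OF P T, of e] meet e phi_not_supp[OF T eE] by auto
  \<comment> \<open>The numerator is nonnegative, so passing to the larger denominator
    \<open>A ?R e\<close> weakens the left side of (P4), and the common denominator cancels.\<close>
  moreover have "(r T - r ?Q) / A ?R e \<le> (r T - r ?Q) / A T e"
    using QT pos le by (intro divide_left_mono) auto
  ultimately have "(r T - r ?Q) / A ?R e \<le> (r ?R - r ?P) / A ?R e" by simp
  then have "r T - r ?Q \<le> r ?R - r ?P" using pos le by (simp add: divide_le_cancel)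
  then show ?thesis using QP QT RS unfolding rank_drop_def by (simp add: max_def)
qed

lemma truncation_mono:
  assumes "S \<in> carrier L" "T \<in> carrier L" "T \<sqsubseteq> S" "e \<in> E"
  shows "A' T e \<le> A' S e"
proof (cases "e \<in> supp E A T")
  case True
  then show ?thesis
    using rank_drop_mono[OF assms(1-3) True] col_mono[OF assms(2,1,3,4)]
    by (auto simp: truncation_def)
next
  case False
  then show ?thesis using truncation_eq_0 truncation_nonneg assms by auto
qed

section \<open>Validity of the truncated system\<close>

lemma supp_phi_psubset:
  assumes "S \<in> carrier L" "e \<in> supp E A S"
  shows "supp E A (\<phi> e S) \<subset> supp E A S"
proof -
  have e: "e \<in> E" using assms(2) by (simp add: supp_def)
  show ?thesis
    using supp_mono[OF phi_closed[OF assms(1) e] assms(1) phi_le[OF assms(1) e]]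
      phi_not_supp[OF assms(1) e] assms(2) by blast
qed

text \<open>Knapsack-cover argument: if some chosen column \<open>e\<close> is really truncated, one copy of it
  covers the rank drop from \<open>S\<close> to \<open>\<phi> e S\<close>, and the rest is covered by induction.\<close>
lemma feasible_truncation:
  assumes x: "feasible E L A r x" and S: "S \<in> carrier L"
  shows "max (r S) 0 \<le> (\<Sum>e\<in>E. A' S e * of_int (x e))"
  using S
proof (induction "card (supp E A S)" arbitrary: S rule: less_induct)
  case less
  have x0: "0 \<le> x e" if "e \<in> E" for e using x that by (auto simp: feasible_def)
  have nn: "0 \<le> A' T e * of_int (x e)" if "T \<in> carrier L" "e \<in> E" for T e
    using truncation_nonneg[OF that] x0[OF that(2)] by simp
  show ?case
  proof (cases "\<exists>e\<in>E. x e \<ge> 1 \<and> A' S e \<noteq> A S e")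
    case False
    have "A' S e * of_int (x e) = A S e * of_int (x e)" if "e \<in> E" for e
      using False x0[OF that] that by (cases "x e = 0") auto
    then have "(\<Sum>e\<in>E. A' S e * real_of_int (x e)) = (\<Sum>e\<in>E. A S e * of_int (x e))"
      by (rule sum.cong[OF HOL.refl])
    then have "r S \<le> (\<Sum>e\<in>E. A' S e * of_int (x e))"
      using x less.prems by (simp add: feasible_def)
    moreover have "0 \<le> (\<Sum>e\<in>E. A' S e * of_int (x e))"
      using nn[OF less.prems] by (intro sum_nonneg) auto
    ultimately show ?thesis by simp
  next
    case True
    then obtain e where e: "e \<in> E" "x e \<ge> 1" "A' S e \<noteq> A S e" by blast
    then have eq: "A' S e = rdrop S e" by (auto simp: truncation_def)
    \<comment> \<open>Outside the support both entries are 0, so entries that differ put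
      \<open>e\<close> in the support. Hence the support of \<open>\<phi> e S\<close> is strictly
      smaller and the induction applies.\<close>
    have supp: "e \<in> supp E A S" using e truncation_eq_0 not_supp_iff less.prems by metis
    let ?T = "\<phi> e S"
    have T: "?T \<in> carrier L" "?T \<sqsubseteq> S" using phi_closed phi_le less.prems e by auto
    have fin: "finite (supp E A S)" using finite_columns by (simp add: supp_def)
    have "max (r ?T) 0 \<le> (\<Sum>f\<in>E. A' ?T f * of_int (x f))"
      using less.hyps[OF _ T(1)] psubset_card_mono[OF fin supp_phi_psubset[OF less.prems supp]] by simp
    \<comment> \<open>The row \<open>?T\<close> avoids \<open>e\<close>, so its bound uses no copy
      of \<open>e\<close>; the copies remain available for the rank drop.\<close>
    also have "\<dots> = (\<Sum>f\<in>E-{e}. A' ?T f * of_int (x f))"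
      using truncation_eq_0[OF T(1) e(1)] phi_not_supp less.prems e
      by (simp add: sum.remove[OF finite_columns e(1)])
    also have "\<dots> \<le> (\<Sum>f\<in>E-{e}. A' S f * of_int (x f))"
      using truncation_mono[OF less.prems T] x0 by (intro sum_mono mult_right_mono) auto
    finally have "max (r ?T) 0 \<le> (\<Sum>f\<in>E-{e}. A' S f * of_int (x f))" .
    moreover have "rdrop S e * 1 \<le> A' S e * of_int (x e)"
      unfolding eq using e rank_drop_nonneg[OF less.prems e(1)] by (intro mult_left_mono) auto
    ultimately have "max (r ?T) 0 + rdrop S e \<le>
        (\<Sum>f\<in>E-{e}. A' S f * of_int (x f)) + A' S e * of_int (x e)"
      by (intro add_mono) simp_all
    then show ?thesis
      using sum.remove[OF finite_columns e(1), of "\<lambda>f. A' S f * of_int (x f)"]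
      by (simp add: rank_drop_def add.commute)
  qed
qed

section \<open>Weak duality and the optimum\<close>

text \<open>The usual exchange of sums, with \<open>feasible_truncation\<close> in the place of
  primal feasibility: \<open>x\<close> is only assumed feasible for \<open>A\<close>, while
  \<open>y\<close> is dual feasible for \<open>A'\<close>.\<close>

lemma weak_duality:
  assumes x: "feasible E L A r x"
    and y: "\<And>S. S \<in> carrier L \<Longrightarrow> 0 \<le> y S"
    and dual: "\<And>e. e \<in> E \<Longrightarrow> (\<Sum>S\<in>carrier L. A' S e * y S) \<le> c e"
  shows "(\<Sum>S\<in>carrier L. y S * r S) \<le> cost E c x"
proof -
  have "(\<Sum>S\<in>carrier L. y S * r S) \<le> (\<Sum>S\<in>carrier L. y S * (\<Sum>e\<in>E. A' S e * of_int (x e)))"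
    using feasible_truncation[OF x] y by (intro sum_mono mult_left_mono) auto
  also have "\<dots> = (\<Sum>e\<in>E. (\<Sum>S\<in>carrier L. A' S e * y S) * of_int (x e))"
    unfolding sum_distrib_left sum_distrib_right by (subst sum.swap) (simp add: mult_ac)
  also have "\<dots> \<le> cost E c x"
    unfolding cost_def using dual x by (intro sum_mono mult_right_mono) (auto simp: feasible_def)
  finally show ?thesis .
qed

text \<open>Makes the set in \<open>opt\<close> nonempty, so that a lower bound on all costs also
  bounds their real infimum.\<close>

lemma feasible_exists: "\<exists>x. feasible E L A r x"
proof -
  \<comment> \<open>\<open>N\<close> dominates every ratio \<open>\<bar>r S\<bar> / A S e\<close>,
    so \<open>\<lceil>N\<rceil>\<close> copies of any column in the support of \<open>S\<close>
    cover \<open>S\<close>. Ratios with a zero entry are 0.\<close>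
  define N where "N = (\<Sum>S\<in>carrier L. \<Sum>e\<in>E. \<bar>r S\<bar> / A S e)"
  have q: "0 \<le> \<bar>r S\<bar> / A S e" if "S \<in> carrier L" "e \<in> E" for S e using nonneg[OF that] by simp
  have N0: "0 \<le> N" unfolding N_def using q by (intro sum_nonneg) auto
  have "r S \<le> (\<Sum>e\<in>E. A S e * of_int \<lceil>N\<rceil>)" if S: "S \<in> carrier L" for S
  proof (cases "supp E A S = {}")
    case True
    have "0 \<le> (\<Sum>e\<in>E. A S e * of_int \<lceil>N\<rceil>)"
      using nonneg[OF S] N0 by (intro sum_nonneg mult_nonneg_nonneg) auto
    then show ?thesis using rank_nonpos_if_supp_empty[OF S True] by simp
  next
    case False
    then obtain e where e: "e \<in> E" "0 < A S e" by (auto simp: supp_def)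
    have "\<bar>r S\<bar> / A S e \<le> (\<Sum>e\<in>E. \<bar>r S\<bar> / A S e)"
      using q[OF S] e finite_columns by (intro member_le_sum) auto
    also have "\<dots> \<le> N"
      unfolding N_def using q S finite_rows
      by (intro member_le_sum[of S "carrier L" "\<lambda>S. \<Sum>e\<in>E. \<bar>r S\<bar> / A S e"] sum_nonneg) auto
    also have "N \<le> of_int \<lceil>N\<rceil>" by simp
    finally have "r S \<le> A S e * of_int \<lceil>N\<rceil>" using e by (simp add: field_simps)
    also have "\<dots> \<le> (\<Sum>e\<in>E. A S e * of_int \<lceil>N\<rceil>)"
      using nonneg[OF S] N0 e finite_columns
      by (intro member_le_sum[of e E "\<lambda>e. A S e * of_int \<lceil>N\<rceil>"]) auto
    finally show ?thesis .
  qed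
  moreover have "0 \<le> \<lceil>N\<rceil>" using N0 by simp
  ultimately have "feasible E L A r (\<lambda>_. \<lceil>N\<rceil>)" by (simp add: feasible_def)
  then show ?thesis by blast
qed

lemma dual_le_opt:
  assumes "\<And>S. S \<in> carrier L \<Longrightarrow> 0 \<le> y S"
    and "\<And>e. e \<in> E \<Longrightarrow> (\<Sum>S\<in>carrier L. A' S e * y S) \<le> c e"
  shows "(\<Sum>S\<in>carrier L. y S * r S) \<le> opt E L A r c"
  unfolding opt_def
  using feasible_exists weak_duality[OF _ assms] by (intro cInf_greatest) auto

section \<open>The factors delta and b and the cost of one step\<close>

lemma delta_entry_le_delta:
  assumes "S \<in> carrier L" "e \<in> E"
  shows "delta_entry E L A r S e \<le> delta E L A r"
  unfolding delta_def using assms finite_rows finite_columns by (intro Max_ge) force+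

text \<open>An entry is 1 or compares the full row with a smaller row, where
  \<open>truncation_mono\<close> applies. A column is required for the maximum to be over a nonempty
  set.\<close>

lemma delta_ge_1:
  assumes "E \<noteq> {}"
  shows "1 \<le> delta E L A r"
proof -
  obtain e where e: "e \<in> E" using assms by blast
  obtain S where S: "S \<in> carrier L" using full_row by blast
  have "1 \<le> delta_entry E L A r S e"
    using truncation_mono[OF full_row_closed S le_full_row[OF S] e]
    by (auto simp: delta_entry_def divide_simps)
  then show ?thesis using delta_entry_le_delta[OF S e] by simp
qed

lemma b_factor_ge_1: "1 \<le> b_factor E L A r"
  by (simp add: b_factor_def)

text \<open>A natural ratio is not rounded. Otherwise the ratio is at least 1 because
  \<open>A' S e \<le> rdrop S e\<close>, so rounding up at most doubles it.\<close>

lemma ceiling_ratio_le: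
  assumes "S \<in> carrier L" "e \<in> E" "0 < A' S e"
  shows "of_int \<lceil>rdrop S e / A' S e\<rceil> \<le> b_factor E L A r * (rdrop S e / A' S e)"
proof (cases "rdrop S e / A' S e \<in> \<nat>")
  case True
  then have "of_int \<lceil>rdrop S e / A' S e\<rceil> = 1 * (rdrop S e / A' S e)"
    by (metis Nats_cases ceiling_of_nat mult_1 of_int_of_nat_eq)
  also have "\<dots> \<le> b_factor E L A r * (rdrop S e / A' S e)"
    using b_factor_ge_1 rank_drop_nonneg[OF assms(1,2)] assms(3)
    by (intro mult_right_mono) auto
  finally show ?thesis .
next
  case False
  have "e \<in> supp E A S" using assms truncation_eq_0 by force
  then have "b_factor E L A r = 2" using False assms by (auto simp: b_factor_def)
  moreover have "A' S e \<le> rdrop S e" by (simp add: truncation_def)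
  then have "1 \<le> rdrop S e / A' S e" using assms by simp
  ultimately show ?thesis by (simp only:) linarith
qed

text \<open>If the entry at \<open>(S, e)\<close> is excluded from the definition of \<open>\<delta>\<close>, it equals the whole rank
  drop, so a single copy of \<open>e\<close> is bought and costs at most \<open>r T\<close> in row \<open>T\<close>.\<close>
lemma step_bound:
  assumes S: "S \<in> carrier L" and T: "T \<in> carrier L" and e: "e \<in> E" and pos: "0 < A' S e"
    and rT: "0 \<le> r T"
  shows "A' T e * of_int \<lceil>rdrop S e / A' S e\<rceil> \<le>
    b_factor E L A r * delta E L A r * rdrop S e + (if r (\<phi> e S) < 0 then r T else 0)"
proof -
  let ?b = "b_factor E L A r" and ?d = "delta E L A r"
  have d1: "1 \<le> ?d" using delta_ge_1 e by blast
  have nn: "0 \<le> ?b * ?d * rdrop S e"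
    using rank_drop_nonneg[OF S e] b_factor_ge_1 d1 by simp
  show ?thesis
  proof (cases "0 \<le> r (\<phi> e S) \<or> A' S e = A S e")
    case True
    have "A' T e \<le> A' (full_row E L A) e"
      using truncation_mono[OF full_row_closed T le_full_row[OF T] e] .
    also have "\<dots> = delta_entry E L A r S e * A' S e"
      using True pos by (simp add: delta_entry_def)
    also have "\<dots> \<le> ?d * A' S e"
      using delta_entry_le_delta[OF S e] pos by simp
    finally have row: "A' T e \<le> ?d * A' S e" .
    have "0 \<le> rdrop S e / A' S e" using rank_drop_nonneg[OF S e] pos by simp
    then have "0 \<le> \<lceil>rdrop S e / A' S e\<rceil>" by linarith
    then have "A' T e * of_int \<lceil>rdrop S e / A' S e\<rceil> \<le> (?d * A' S e) * (?b * (rdrop S e / A' S e))"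
      using ceiling_ratio_le[OF S e pos] row d1 pos
      by (intro mult_mono) auto
    also have "\<dots> = ?b * ?d * rdrop S e" using pos by simp
    finally show ?thesis using rT by simp
  next
    case False
    then have "rdrop S e / A' S e = 1" using pos by (auto simp: truncation_def)
    then show ?thesis using False nn truncation_le_rank[OF T e] rT by simp
  qed
qed

section \<open>The invariant of the algorithm\<close>

lemma dual_sum_upd:
  assumes "S \<in> carrier L"
  shows "(\<Sum>T\<in>carrier L. M T e * (y(S := y S + t)) T) = (\<Sum>T\<in>carrier L. M T e * y T) + M S e * (t :: real)"
  using sum.remove[OF finite_rows assms, of "\<lambda>T. M T e * y T"]
  by (simp add: sum.remove[OF finite_rows assms] algebra_simps)

text \<open>Disjointness of \<open>F\<close> from the current support keeps tight constraints tight
  when \<open>y S\<close> is raised. The last clause is the charge to row \<open>T\<close>: the rank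
  drops so far telescope to \<open>r T - max (r S) 0\<close>, and the extra \<open>r T\<close> pays
  for reaching negative rank.\<close>

definition pd_invariant ::
  "('a \<Rightarrow> real) \<Rightarrow> 'b \<Rightarrow> 'a set \<Rightarrow> ('b \<Rightarrow> real) \<Rightarrow> ('a \<Rightarrow> int) \<Rightarrow> bool" where
  "pd_invariant c S F y x \<longleftrightarrow>
    S \<in> carrier L \<and> F \<subseteq> E \<and> F \<inter> supp E A S = {} \<and>
    (\<forall>T. 0 \<le> y T) \<and> (\<forall>T. 0 < y T \<longrightarrow> 0 < r T) \<and>
    (\<forall>e\<in>E. (\<Sum>T\<in>carrier L. A' T e * y T) \<le> c e) \<and>
    (\<forall>e\<in>F. (\<Sum>T\<in>carrier L. A' T e * y T) = c e) \<and>
    (\<forall>e. e \<notin> F \<longrightarrow> x e = 0) \<and>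
    (\<forall>T\<in>carrier L. 0 < y T \<longrightarrow> (\<Sum>e\<in>F. A' T e * of_int (x e)) \<le>
      b_factor E L A r * delta E L A r * (r T - max (r S) 0) + (if r S < 0 then r T else 0))"

lemma pd_state_invariant:
  assumes c: "\<And>e. e \<in> E \<Longrightarrow> 0 \<le> c e"
    and "pd_state E L A r c A' S F y x"
  shows "pd_invariant c S F y x"
  using assms(2)
proof (induction rule: pd_state.induct)
  case init
  then show ?case
    using c top_eq_full_row full_row_closed by (auto simp: pd_invariant_def)
next
  case (step S F y x e t y')
  let ?K = "b_factor E L A r * delta E L A r"
  let ?S = "\<phi> e S"
  let ?n = "\<lceil>rdrop S e / A' S e\<rceil>"
  \<comment> \<open>Since \<open>r S > 0\<close>, the positive part in the charge is
    \<open>r S\<close> and the extra term is still absent.\<close>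
  have S: "S \<in> carrier L" and F: "F \<subseteq> E" "F \<inter> supp E A S = {}"
    and y: "\<And>T. 0 \<le> y T" "\<And>T. 0 < y T \<Longrightarrow> 0 < r T"
    and dual: "\<And>f. f \<in> E \<Longrightarrow> (\<Sum>T\<in>carrier L. A' T f * y T) \<le> c f"
    and tight: "\<And>f. f \<in> F \<Longrightarrow> (\<Sum>T\<in>carrier L. A' T f * y T) = c f"
    and x: "\<And>f. f \<notin> F \<Longrightarrow> x f = 0"
    and bound: "\<And>T. T \<in> carrier L \<Longrightarrow> 0 < y T \<Longrightarrow>
      (\<Sum>f\<in>F. A' T f * of_int (x f)) \<le> ?K * (r T - r S)"
    using step.IH \<open>0 < r S\<close> unfolding pd_invariant_def by auto
  have e: "e \<in> E" "e \<notin> F" using step by auto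
  have S': "?S \<in> carrier L" "?S \<sqsubseteq> S" using phi_closed phi_le S e by auto
  have zero: "A' S f = 0" if "f \<in> F" for f
    using truncation_eq_0[OF S] F that by blast
  have y'_sum: "(\<Sum>T\<in>carrier L. A' T f * y' T) = (\<Sum>T\<in>carrier L. A' T f * y T) + A' S f * t" for f
    unfolding \<open>y' = _\<close> by (rule dual_sum_upd[OF S])
  have tight': "(\<Sum>T\<in>carrier L. A' T f * y' T) = c f" if "f \<in> insert e F" for f
    using that step tight y'_sum[of f] zero by auto
  \<comment> \<open>Columns with a zero entry in row \<open>S\<close>, among them all of
    \<open>F\<close>, are unaffected by the increase; the others are controlled by the choice of
    \<open>e\<close> as first to become tight.\<close>
  have dual': "(\<Sum>T\<in>carrier L. A' T f * y' T) \<le> c f" if f: "f \<in> E" for f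
  proof (cases "f \<in> F \<or> A' S f = 0")
    case True
    then show ?thesis using y'_sum[of f] zero dual[OF f] by auto
  next
    case False
    then have "0 < A' S f" using truncation_nonneg[OF S f] by simp
    then show ?thesis using False f step by blast
  qed
  have bound': "(\<Sum>f\<in>insert e F. A' T f * of_int ((x(e := ?n)) f)) \<le>
      ?K * (r T - max (r ?S) 0) + (if r ?S < 0 then r T else 0)"
    if T: "T \<in> carrier L" and yT: "0 < y' T" for T
  proof -
    have rT: "0 < r T" using yT step y by (cases "T = S") auto
    have "(\<Sum>f\<in>F. A' T f * of_int (x f)) \<le> ?K * (r T - r S)"
    \<comment> \<open>Here \<open>y S\<close> may have been 0 before the step, so the invariant says
      nothing about this row; but the chosen columns all have entry 0 in it.\<close>
    proof (cases "T = S")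
      case True
      then show ?thesis using zero by simp
    next
      case False
      then show ?thesis using bound[OF T] yT step by simp
    qed
    moreover have "A' T e * of_int ?n \<le> ?K * rdrop S e + (if r ?S < 0 then r T else 0)"
      using step_bound[OF S T e(1)] step rT by simp
    moreover have "rdrop S e = r S - max (r ?S) 0"
      using \<open>0 < r S\<close> by (simp add: rank_drop_def)
    moreover have "(\<Sum>f\<in>insert e F. A' T f * of_int ((x(e := ?n)) f)) =
        A' T e * of_int ?n + (\<Sum>f\<in>F. A' T f * of_int (x f))"
      using e finite_subset[OF F(1) finite_columns]
      by (simp add: sum.insert) (intro sum.cong; auto)
    ultimately have "(\<Sum>f\<in>insert e F. A' T f * of_int ((x(e := ?n)) f)) \<le>
        ?K * (r T - r S) + ?K * (r S - max (r ?S) 0) + (if r ?S < 0 then r T else 0)"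
      by (simp only:)
    then show ?thesis by (simp add: distrib_left[symmetric])
  qed
  have "insert e F \<inter> supp E A ?S = {}"
    using F supp_mono[OF S'(1) S S'(2)] phi_not_supp[OF S e(1)] by blast
  moreover have "0 \<le> y' T" for T using step y by simp
  moreover have "0 < r T" if "0 < y' T" for T using that step y by (cases "T = S") auto
  ultimately have "pd_invariant c ?S (insert e F) y' (x(e := ?n))"
    unfolding pd_invariant_def
    using S' F e dual' tight' bound' x by (intro conjI) auto
  then show ?case by (simp add: rank_drop_def fun_upd_def)
qed

section \<open>Charging the cost to the dual\<close>

text \<open>Tightness on \<open>F\<close> rewrites the cost as a sum over rows weighted by
  \<open>y\<close>, to be compared with the dual value. \<open>K\<close> stays general to serve both
  cases of the guarantee.\<close>

lemma invariant_cost_le: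
  assumes inv: "pd_invariant c S F y x" and K: "0 \<le> K"
    and bound: "\<And>T. T \<in> carrier L \<Longrightarrow> 0 < y T \<Longrightarrow> (\<Sum>e\<in>F. A' T e * of_int (x e)) \<le> K * r T"
  shows "cost E c x \<le> K * opt E L A r c"
proof -
  have F: "F \<subseteq> E" and y: "\<And>T. 0 \<le> y T"
    and dual: "\<And>f. f \<in> E \<Longrightarrow> (\<Sum>T\<in>carrier L. A' T f * y T) \<le> c f"
    and tight: "\<And>f. f \<in> F \<Longrightarrow> (\<Sum>T\<in>carrier L. A' T f * y T) = c f"
    and x: "\<And>f. f \<notin> F \<Longrightarrow> x f = 0"
    using inv by (auto simp: pd_invariant_def)
  have "cost E c x = (\<Sum>e\<in>F. c e * of_int (x e))"
    unfolding cost_def using F x finite_columns by (intro sum.mono_neutral_right) auto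
  also have "\<dots> = (\<Sum>e\<in>F. (\<Sum>T\<in>carrier L. A' T e * y T) * of_int (x e))"
    using tight by simp
  also have "\<dots> = (\<Sum>T\<in>carrier L. y T * (\<Sum>e\<in>F. A' T e * of_int (x e)))"
    unfolding sum_distrib_left sum_distrib_right by (subst sum.swap) (simp add: mult_ac)
  also have "\<dots> \<le> (\<Sum>T\<in>carrier L. y T * (K * r T))"
  proof (rule sum_mono)
    fix T assume "T \<in> carrier L"
    then show "y T * (\<Sum>e\<in>F. A' T e * of_int (x e)) \<le> y T * (K * r T)"
      using bound[of T] y[of T] by (cases "y T = 0") (auto intro: mult_left_mono)
  qed
  also have "\<dots> = K * (\<Sum>T\<in>carrier L. y T * r T)"
    by (simp add: sum_distrib_left mult_ac)
  also have "\<dots> \<le> K * opt E L A r c"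
    using dual_le_opt[OF y dual] K by (rule mult_left_mono)
  finally show ?thesis .
qed

lemma opt_no_columns:
  assumes "E = {}"
  shows "opt E L A r c = 0"
proof -
  have "{cost E c x |x. feasible E L A r x} = {0}"
    using feasible_exists assms by (auto simp: cost_def)
  then show ?thesis by (simp add: opt_def)
qed

lemma approximation_guarantee:
  assumes c: "\<And>e. e \<in> E \<Longrightarrow> 0 \<le> c e"
    and out: "pd_greedy_output E L A r c A' x y"
  defines "K \<equiv> b_factor E L A r * delta E L A r"
  shows "if \<forall>S \<in> carrier L. r S \<ge> 0
    then cost E c x \<le> K * opt E L A r c else cost E c x \<le> (K + 1) * opt E L A r c"
\<comment> \<open>Without columns \<open>delta\<close> is an unspecified maximum, but both the cost
  and \<open>opt\<close> are 0.\<close>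
proof (cases "E = {}")
  case True
  then show ?thesis using opt_no_columns by (simp add: cost_def)
next
  case False
  have K: "0 \<le> K" using delta_ge_1[OF False] b_factor_ge_1 by (simp add: K_def)
  obtain S F where state: "pd_state E L A r c A' S F y x" and S: "r S \<le> 0"
    using out by (auto simp: pd_greedy_output_def)
  note inv = pd_state_invariant[OF c state]
  \<comment> \<open>At termination \<open>r S \<le> 0\<close>, so the subtracted positive part is
    0.\<close>
  have mem: "S \<in> carrier L" and pos: "\<And>T. 0 < y T \<Longrightarrow> 0 < r T"
    and bound: "\<And>T. T \<in> carrier L \<Longrightarrow> 0 < y T \<Longrightarrow>
      (\<Sum>e\<in>F. A' T e * of_int (x e)) \<le> K * r T + (if r S < 0 then r T else 0)"
    using inv S by (auto simp: pd_invariant_def K_def max_def)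
  have "cost E c x \<le> K * opt E L A r c" if "\<forall>S \<in> carrier L. r S \<ge> 0"
  proof (rule invariant_cost_le[OF inv K])
    fix T assume "T \<in> carrier L" "0 < y T"
    then show "(\<Sum>e\<in>F. A' T e * of_int (x e)) \<le> K * r T"
      using bound[of T] that mem by (auto split: if_splits)
  qed
  \<comment> \<open>A last row of negative rank costs one more \<open>r T\<close> per charged row,
    hence the additional 1.\<close>
  moreover have "cost E c x \<le> (K + 1) * opt E L A r c"
  proof (rule invariant_cost_le[OF inv])
    show "0 \<le> K + 1" using K by simp
    fix T assume "T \<in> carrier L" "0 < y T"
    then show "(\<Sum>e\<in>F. A' T e * of_int (x e)) \<le> (K + 1) * r T"
      using bound[of T] pos[of T] by (auto simp: algebra_simps split: if_splits)
  qed
  ultimately show ?thesis by simp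
qed

end

theorem theorem1:
  fixes E :: "'e set" and L :: "('l, 'm) gorder_scheme"
    and A :: "'l \<Rightarrow> 'e \<Rightarrow> real" and r :: "'l \<Rightarrow> real" and c :: "'e \<Rightarrow> real"
    and x :: "'e \<Rightarrow> int" and y :: "'l \<Rightarrow> real"
  assumes "greedy_system E L A r"
    and "\<exists>S \<in> carrier L. supp E A S = {} \<and> r S \<le> 0"
    and "\<exists>S \<in> carrier L. supp E A S = E"
    and "\<forall>e \<in> E. c e \<ge> 0"
    and "pd_greedy_output E L A r c (truncation E L A r) x y"
  shows "if \<forall>S \<in> carrier L. r S \<ge> 0
         then cost E c x \<le> b_factor E L A r * delta E L A r * opt E L A r c
         else cost E c x \<le> (b_factor E L A r * delta E L A r + 1) * opt E L A r c"
proof -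
  interpret bounded_greedy_system E L A r
    using assms(1-3) by (simp add: bounded_greedy_system_def bounded_greedy_system_axioms_def)
  show ?thesis using approximation_guarantee assms(4,5) by blast
qed

end
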